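(* For any fixed pair of optimal primal and Lagrangian dual solutions of the Combined Storage Model, with $LME_{i,t}=p_{\pi,i,t}+p_o\pi_{i,t}$ and $SCI_{\ell,t}=p^+_{\rho,\ell,t}-p^-_{\rho,\ell,t}+p_o(\rho^+_{\ell,t}-\rho^-_{\ell,t})$, the carbon accounts of all loads, generators, transmission lines and storage sum to the total system carbon emissions: $$\sum_{t\in T}\sum_{g\in G}\sigma_gP^G_{g,t}=\sum_{t\in T}\Bigg(\sum_{i\in N}LME_{i,t}P^D_{i,t}+\sum_{g\in G}(\sigma_g-LME_{g,t})P^G_{g,t}+\sum_{\ell\in L}SCI_{\ell,t}|f_{\ell,t}|+\sum_{s\in S}LME_{s,t}\,(P^{S+}_{s,t}-P^{S-}_{s,t})\Bigg).$$
   Context: **Data.** $N$ finite set of nodes; $G$ finite set of generators, $G_i$ those at node $i$; $S$ finite set of storage resources, $S_i$ those at node $i$ (each generator and storage resource is at exactly one node); $L$ finite set of directed lines $\ell=(i,j)$ with admittance $B_\ell=B_{ij}$; $T=\{1,\dots,m\}$ the dispatch periods. Real parameters: $c_g,\sigma_g,P^{min}_g,P^{max}_g,f^{max}_\ell,E^{max}_s,P^D_{i,t}$ and efficiency $\eta\in(0,1]$. A nodal quantity subscripted by a generator or storage resource means its value at the node where that resource is located. **Storage DC-OPF.** Minimize $\sum_{t\in T}\sum_{g\in G}c_gP^G_{g,t}$ over $(P^G,\theta,f,P^{S+},P^{S-},E)$ subject to, for all $t\in T$: $B_{ij}(\theta_{i,t}-\theta_{j,t})-f_{\ell,t}=0$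 for $\ell=(i,j)\in L$ $[z_{\ell,t}]$; $\sum_{g\in G_i}P^G_{g,t}-\sum_{\ell=(i,j)\in L}f_{\ell,t}+\sum_{\ell=(j,i)\in L}f_{\ell,t}-\sum_{s\in S_i}(P^{S+}_{s,t}-P^{S-}_{s,t})=P^D_{i,t}$ for $i\in N$ $[\pi_{i,t}]$; $f_{\ell,t}\le f^{max}_\ell$ $[\rho^+_{\ell,t}]$; $f_{\ell,t}\ge-f^{max}_\ell$ $[\rho^-_{\ell,t}]$; $P^G_{g,t}\le P^{max}_g$ $[\gamma^+_{g,t}]$; $P^G_{g,t}\ge P^{min}_g$ $[\gamma^-_{g,t}]$; $E_{s,t}+\eta P^{S+}_{s,t}-\frac1\eta P^{S-}_{s,t}-E_{s,t+1}=0$ for $s\in S$ $[\alpha_{s,t}]$; $P^{S+}_{s,t},P^{S-}_{s,t}\ge0$; and $0\le E_{s,t}\le E^{max}_s$ for all periods $t=2,\dots,m+1$ [$\beta^-_{s,t}$ for $\ge0$, $\beta^+_{s,t}$ for $\le E^{max}_s$], where $E_{s,1}=0$. **Combined Storage Model.** Minimize $\sum_{t\in T}\sum_{g\in G}\sigma_gP^G_{g,t}$ over the storage DC-OPF variables and $(\pi,\gamma^\pm,\rho^\pm,z,\alpha,\beta^\pm,\tau^\pm)$ subject to all constraints of the storage DC-OPF, its dual constraints (for $t\in T$): $\gamma^+_{g,t}+\gamma^-_{g,t}+\sum_{i\mid g\in G_i}\pi_{i,t}=c_g$; $-z_{\ell,t}+\rho^+_{\ell,t}+\rho^-_{\ell,t}-\pi_{i,t}+\pi_{j,t}=0$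 for $\ell=(i,j)$; $\sum_{\ell=(i,j)\in L}B_\ell z_{\ell,t}-\sum_{\ell=(j,i)\in L}B_\ell z_{\ell,t}=0$ for $i\in N$; $-\sum_{i\mid s\in S_i}\pi_{i,t}+\eta\alpha_{s,t}+\tau^+_{s,t}=0$; $\sum_{i\mid s\in S_i}\pi_{i,t}-\frac1\eta\alpha_{s,t}+\tau^-_{s,t}=0$; $\beta^+_{s,t}+\beta^-_{s,t}+\alpha_{s,t}-\alpha_{s,t-1}=0$ for $t=2,\dots,m+1$ with the convention $\alpha_{s,m+1}=0$; $\rho^+,\gamma^+,\beta^+\le0$; $\rho^-,\gamma^-,\beta^-,\tau^+,\tau^-\ge0$; and the strong duality constraint $$\sum_{t\in T}\Big(\sum_gc_gP^G_{g,t}-\sum_iP^D_{i,t}\pi_{i,t}-\sum_\ell(\rho^+_{\ell,t}-\rho^-_{\ell,t})f^{max}_\ell-\sum_g(\gamma^+_{g,t}P^{max}_g+\gamma^-_{g,t}P^{min}_g)\Big)-\sum_{s}\sum_{t=2}^{m+1}\beta^+_{s,t}E^{max}_s\le0.$$ **Multipliers.** $p$ denotes a Lagrangian dual solution of this linear program, with Lagrangian equal to the objective minus the sum of multiplier times (left side minus right side), so multipliers of $\le$ constraints are $\le0$, of $\ge$ constraints $\ge0$, of equalities free. $p_{\pi,i,t}$ is the multiplier of the flow balance constraint, $p^+_{\rho,\ell,t}$ of $f_{\ell,t}\le f^{max}_\ell$, $p^-_{\rho,\ell,t}$ of $f_{\ell,t}\ge-f^{max}_\ell$, and $p_o$ of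 the strong duality constraint. *)

theory Defs
  imports "HOL-Analysis.Analysis"
begin

section \<open>Programs with a finite family of constraints, and Lagrangian duality\<close>

datatype sense = LE | GE | EQ

record ('c, 'x) program =
  constrs :: "'c set"
  lhs :: "'c \<Rightarrow> 'x \<Rightarrow> real"
  sense_of :: "'c \<Rightarrow> sense"
  rhs :: "'c \<Rightarrow> real"
  objective :: "'x \<Rightarrow> real"

primrec holds :: "sense \<Rightarrow> real \<Rightarrow> real \<Rightarrow> bool" where
  "holds LE a b \<longleftrightarrow> a \<le> b"
| "holds GE a b \<longleftrightarrow> a \<ge> b"
| "holds EQ a b \<longleftrightarrow> a = b"

definition feasible :: "('c, 'x) program \<Rightarrow> 'x \<Rightarrow> bool" where
  "feasible P x \<longleftrightarrow> (\<forall>k\<in>constrs P. holds (sense_of P k) (lhs P k x) (rhs P k))"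

definition optimal :: "('c, 'x) program \<Rightarrow> 'x \<Rightarrow> bool" where
  "optimal P x \<longleftrightarrow> feasible P x \<and> (\<forall>y. feasible P y \<longrightarrow> objective P x \<le> objective P y)"

primrec sign_ok :: "sense \<Rightarrow> real \<Rightarrow> bool" where
  "sign_ok LE q \<longleftrightarrow> q \<le> 0"
| "sign_ok GE q \<longleftrightarrow> q \<ge> 0"
| "sign_ok EQ q \<longleftrightarrow> True"

definition lagrangian :: "('c, 'x) program \<Rightarrow> 'x \<Rightarrow> ('c \<Rightarrow> real) \<Rightarrow> real" where
  "lagrangian P x p = objective P x - (\<Sum>k\<in>constrs P. p k * (lhs P k x - rhs P k))"

definition dual_feasible :: "('c, 'x) program \<Rightarrow> ('c \<Rightarrow> real) \<Rightarrow> bool" where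
  "dual_feasible P p \<longleftrightarrow> (\<forall>k\<in>constrs P. sign_ok (sense_of P k) (p k))"

text \<open>The infimum is over all \<open>x\<close>: every constraint, including sign constraints on single
  variables, is dualised. It is taken in \<^typ>\<open>ereal\<close> because it may be \<open>-\<infinity>\<close>.\<close>

definition dual_function :: "('c, 'x) program \<Rightarrow> ('c \<Rightarrow> real) \<Rightarrow> ereal" where
  "dual_function P p = (INF x. ereal (lagrangian P x p))"

definition dual_optimal :: "('c, 'x) program \<Rightarrow> ('c \<Rightarrow> real) \<Rightarrow> bool" where
  "dual_optimal P p \<longleftrightarrow> dual_feasible P p \<and>
     (\<forall>q. dual_feasible P q \<longrightarrow> dual_function P q \<le> dual_function P p)"

section \<open>Network data\<close>

text \<open>A line is the ordered pair of its end nodes. \<open>gen_node\<close> and \<open>sto_node\<close> give the unique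
  node of a resource.\<close>

record ('n, 'g, 's) grid =
  nodes :: "'n set"
  gens :: "'g set"
  stores :: "'s set"
  lines :: "('n \<times> 'n) set"
  gen_node :: "'g \<Rightarrow> 'n"
  sto_node :: "'s \<Rightarrow> 'n"
  num_periods :: nat
  admittance :: "'n \<times> 'n \<Rightarrow> real"
  cost :: "'g \<Rightarrow> real"
  emission :: "'g \<Rightarrow> real"
  pmin :: "'g \<Rightarrow> real"
  pmax :: "'g \<Rightarrow> real"
  fmax :: "'n \<times> 'n \<Rightarrow> real"
  emax :: "'s \<Rightarrow> real"
  demand :: "'n \<Rightarrow> nat \<Rightarrow> real"
  eff :: real

definition valid_grid :: "('n, 'g, 's) grid \<Rightarrow> bool" where
  "valid_grid D \<longleftrightarrow>
     finite (nodes D) \<and> finite (gens D) \<and> finite (stores D) \<and>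
     lines D \<subseteq> nodes D \<times> nodes D \<and>
     gen_node D ` gens D \<subseteq> nodes D \<and> sto_node D ` stores D \<subseteq> nodes D \<and>
     0 < eff D \<and> eff D \<le> 1"

definition periods :: "('n, 'g, 's) grid \<Rightarrow> nat set" where
  "periods D = {1..num_periods D}"

definition sto_periods :: "('n, 'g, 's) grid \<Rightarrow> nat set" where
  "sto_periods D = {2..num_periods D + 1}"

definition gens_at :: "('n, 'g, 's) grid \<Rightarrow> 'n \<Rightarrow> 'g set" where
  "gens_at D i = {g \<in> gens D. gen_node D g = i}"

definition stores_at :: "('n, 'g, 's) grid \<Rightarrow> 'n \<Rightarrow> 's set" where
  "stores_at D i = {s \<in> stores D. sto_node D s = i}"

definition lines_from :: "('n, 'g, 's) grid \<Rightarrow> 'n \<Rightarrow> ('n \<times> 'n) set" where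
  "lines_from D i = {l \<in> lines D. fst l = i}"

definition lines_to :: "('n, 'g, 's) grid \<Rightarrow> 'n \<Rightarrow> ('n \<times> 'n) set" where
  "lines_to D i = {l \<in> lines D. snd l = i}"

section \<open>The combined storage model\<close>

text \<open>The fields up to \<open>energy\<close> are the storage DC-OPF variables; the remaining fields are its
  dual variables: \<open>price\<close> is \<open>\<pi>\<close>, \<open>gam\<close> is \<open>\<gamma>\<close>, and so on, with suffixes \<open>p\<close> and \<open>m\<close>
  for the superscripts \<open>+\<close> and \<open>-\<close>. Values outside the index sets of the grid are irrelevant.\<close>

record ('n, 'g, 's) csm_vars =
  gen :: "'g \<Rightarrow> nat \<Rightarrow> real"
  angle :: "'n \<Rightarrow> nat \<Rightarrow> real"
  flow :: "'n \<times> 'n \<Rightarrow> nat \<Rightarrow> real"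
  charge :: "'s \<Rightarrow> nat \<Rightarrow> real"
  discharge :: "'s \<Rightarrow> nat \<Rightarrow> real"
  energy :: "'s \<Rightarrow> nat \<Rightarrow> real"
  price :: "'n \<Rightarrow> nat \<Rightarrow> real"
  gam_p :: "'g \<Rightarrow> nat \<Rightarrow> real"
  gam_m :: "'g \<Rightarrow> nat \<Rightarrow> real"
  rho_p :: "'n \<times> 'n \<Rightarrow> nat \<Rightarrow> real"
  rho_m :: "'n \<times> 'n \<Rightarrow> nat \<Rightarrow> real"
  zeta :: "'n \<times> 'n \<Rightarrow> nat \<Rightarrow> real"
  alpha :: "'s \<Rightarrow> nat \<Rightarrow> real"
  beta_p :: "'s \<Rightarrow> nat \<Rightarrow> real"
  beta_m :: "'s \<Rightarrow> nat \<Rightarrow> real"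
  tau_p :: "'s \<Rightarrow> nat \<Rightarrow> real"
  tau_m :: "'s \<Rightarrow> nat \<Rightarrow> real"

text \<open>The two boundary conventions: initial energy \<open>E\<^sub>s\<^sub>,\<^sub>1 = 0\<close> and terminal
  \<open>\<alpha>\<^sub>s\<^sub>,\<^sub>m\<^sub>+\<^sub>1 = 0\<close> are constants, not variables.\<close>

definition energy_at :: "('n, 'g, 's) csm_vars \<Rightarrow> 's \<Rightarrow> nat \<Rightarrow> real" where
  "energy_at x s t = (if t = 1 then 0 else energy x s t)"

definition alpha_at :: "('n, 'g, 's) grid \<Rightarrow> ('n, 'g, 's) csm_vars \<Rightarrow> 's \<Rightarrow> nat \<Rightarrow> real" where
  "alpha_at D x s t = (if t = num_periods D + 1 then 0 else alpha x s t)"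

text \<open>Names of the constraints: first those of the storage DC-OPF, then its dual constraints
  (\<open>DualX\<close> is the one belonging to the DC-OPF variable \<open>X\<close>), the signs of the dual
  variables, and strong duality.\<close>

datatype ('n, 'g, 's) con =
    Ohm "'n \<times> 'n" nat
  | Balance 'n nat
  | FlowMax "'n \<times> 'n" nat
  | FlowMin "'n \<times> 'n" nat
  | GenMax 'g nat
  | GenMin 'g nat
  | StoreDynamics 's nat
  | ChargeNonneg 's nat
  | DischargeNonneg 's nat
  | EnergyMax 's nat
  | EnergyMin 's nat
  | DualGen 'g nat
  | DualFlow "'n \<times> 'n" nat
  | DualAngle 'n nat
  | DualCharge 's nat
  | DualDischarge 's nat
  | DualEnergy 's nat
  | RhoPSign "'n \<times> 'n" nat
  | RhoMSign "'n \<times> 'n" nat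
  | GamPSign 'g nat
  | GamMSign 'g nat
  | BetaPSign 's nat
  | BetaMSign 's nat
  | TauPSign 's nat
  | TauMSign 's nat
  | StrongDuality

primrec csm_index :: "('n, 'g, 's) grid \<Rightarrow> ('n, 'g, 's) con \<Rightarrow> bool" where
  "csm_index D (Ohm l t) \<longleftrightarrow> l \<in> lines D \<and> t \<in> periods D"
| "csm_index D (Balance i t) \<longleftrightarrow> i \<in> nodes D \<and> t \<in> periods D"
| "csm_index D (FlowMax l t) \<longleftrightarrow> l \<in> lines D \<and> t \<in> periods D"
| "csm_index D (FlowMin l t) \<longleftrightarrow> l \<in> lines D \<and> t \<in> periods D"
| "csm_index D (GenMax g t) \<longleftrightarrow> g \<in> gens D \<and> t \<in> periods D"
| "csm_index D (GenMin g t) \<longleftrightarrow> g \<in> gens D \<and> t \<in> periods D"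
| "csm_index D (StoreDynamics s t) \<longleftrightarrow> s \<in> stores D \<and> t \<in> periods D"
| "csm_index D (ChargeNonneg s t) \<longleftrightarrow> s \<in> stores D \<and> t \<in> periods D"
| "csm_index D (DischargeNonneg s t) \<longleftrightarrow> s \<in> stores D \<and> t \<in> periods D"
| "csm_index D (EnergyMax s t) \<longleftrightarrow> s \<in> stores D \<and> t \<in> sto_periods D"
| "csm_index D (EnergyMin s t) \<longleftrightarrow> s \<in> stores D \<and> t \<in> sto_periods D"
| "csm_index D (DualGen g t) \<longleftrightarrow> g \<in> gens D \<and> t \<in> periods D"
| "csm_index D (DualFlow l t) \<longleftrightarrow> l \<in> lines D \<and> t \<in> periods D"
| "csm_index D (DualAngle i t) \<longleftrightarrow> i \<in> nodes D \<and> t \<in> periods D"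
| "csm_index D (DualCharge s t) \<longleftrightarrow> s \<in> stores D \<and> t \<in> periods D"
| "csm_index D (DualDischarge s t) \<longleftrightarrow> s \<in> stores D \<and> t \<in> periods D"
| "csm_index D (DualEnergy s t) \<longleftrightarrow> s \<in> stores D \<and> t \<in> sto_periods D"
| "csm_index D (RhoPSign l t) \<longleftrightarrow> l \<in> lines D \<and> t \<in> periods D"
| "csm_index D (RhoMSign l t) \<longleftrightarrow> l \<in> lines D \<and> t \<in> periods D"
| "csm_index D (GamPSign g t) \<longleftrightarrow> g \<in> gens D \<and> t \<in> periods D"
| "csm_index D (GamMSign g t) \<longleftrightarrow> g \<in> gens D \<and> t \<in> periods D"
| "csm_index D (BetaPSign s t) \<longleftrightarrow> s \<in> stores D \<and> t \<in> sto_periods D"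
| "csm_index D (BetaMSign s t) \<longleftrightarrow> s \<in> stores D \<and> t \<in> sto_periods D"
| "csm_index D (TauPSign s t) \<longleftrightarrow> s \<in> stores D \<and> t \<in> periods D"
| "csm_index D (TauMSign s t) \<longleftrightarrow> s \<in> stores D \<and> t \<in> periods D"
| "csm_index D StrongDuality \<longleftrightarrow> True"

primrec csm_sense :: "('n, 'g, 's) con \<Rightarrow> sense" where
  "csm_sense (Ohm l t) = EQ"
| "csm_sense (Balance i t) = EQ"
| "csm_sense (FlowMax l t) = LE"
| "csm_sense (FlowMin l t) = GE"
| "csm_sense (GenMax g t) = LE"
| "csm_sense (GenMin g t) = GE"
| "csm_sense (StoreDynamics s t) = EQ"
| "csm_sense (ChargeNonneg s t) = GE"
| "csm_sense (DischargeNonneg s t) = GE"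
| "csm_sense (EnergyMax s t) = LE"
| "csm_sense (EnergyMin s t) = GE"
| "csm_sense (DualGen g t) = EQ"
| "csm_sense (DualFlow l t) = EQ"
| "csm_sense (DualAngle i t) = EQ"
| "csm_sense (DualCharge s t) = EQ"
| "csm_sense (DualDischarge s t) = EQ"
| "csm_sense (DualEnergy s t) = EQ"
| "csm_sense (RhoPSign l t) = LE"
| "csm_sense (RhoMSign l t) = GE"
| "csm_sense (GamPSign g t) = LE"
| "csm_sense (GamMSign g t) = GE"
| "csm_sense (BetaPSign s t) = LE"
| "csm_sense (BetaMSign s t) = GE"
| "csm_sense (TauPSign s t) = GE"
| "csm_sense (TauMSign s t) = GE"
| "csm_sense StrongDuality = LE"

primrec csm_rhs :: "('n, 'g, 's) grid \<Rightarrow> ('n, 'g, 's) con \<Rightarrow> real" where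
  "csm_rhs D (Ohm l t) = 0"
| "csm_rhs D (Balance i t) = demand D i t"
| "csm_rhs D (FlowMax l t) = fmax D l"
| "csm_rhs D (FlowMin l t) = - fmax D l"
| "csm_rhs D (GenMax g t) = pmax D g"
| "csm_rhs D (GenMin g t) = pmin D g"
| "csm_rhs D (StoreDynamics s t) = 0"
| "csm_rhs D (ChargeNonneg s t) = 0"
| "csm_rhs D (DischargeNonneg s t) = 0"
| "csm_rhs D (EnergyMax s t) = emax D s"
| "csm_rhs D (EnergyMin s t) = 0"
| "csm_rhs D (DualGen g t) = cost D g"
| "csm_rhs D (DualFlow l t) = 0"
| "csm_rhs D (DualAngle i t) = 0"
| "csm_rhs D (DualCharge s t) = 0"
| "csm_rhs D (DualDischarge s t) = 0"
| "csm_rhs D (DualEnergy s t) = 0"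
| "csm_rhs D (RhoPSign l t) = 0"
| "csm_rhs D (RhoMSign l t) = 0"
| "csm_rhs D (GamPSign g t) = 0"
| "csm_rhs D (GamMSign g t) = 0"
| "csm_rhs D (BetaPSign s t) = 0"
| "csm_rhs D (BetaMSign s t) = 0"
| "csm_rhs D (TauPSign s t) = 0"
| "csm_rhs D (TauMSign s t) = 0"
| "csm_rhs D StrongDuality = 0"

primrec csm_lhs ::
  "('n, 'g, 's) grid \<Rightarrow> ('n, 'g, 's) con \<Rightarrow> ('n, 'g, 's) csm_vars \<Rightarrow> real" where
  "csm_lhs D (Ohm l t) = (\<lambda>x.
     admittance D l * (angle x (fst l) t - angle x (snd l) t) - flow x l t)"
| "csm_lhs D (Balance i t) = (\<lambda>x.
     (\<Sum>g\<in>gens_at D i. gen x g t)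
     - (\<Sum>l\<in>lines_from D i. flow x l t) + (\<Sum>l\<in>lines_to D i. flow x l t)
     - (\<Sum>s\<in>stores_at D i. charge x s t - discharge x s t))"
| "csm_lhs D (FlowMax l t) = (\<lambda>x. flow x l t)"
| "csm_lhs D (FlowMin l t) = (\<lambda>x. flow x l t)"
| "csm_lhs D (GenMax g t) = (\<lambda>x. gen x g t)"
| "csm_lhs D (GenMin g t) = (\<lambda>x. gen x g t)"
| "csm_lhs D (StoreDynamics s t) = (\<lambda>x.
     energy_at x s t + eff D * charge x s t - 1 / eff D * discharge x s t
     - energy_at x s (t + 1))"
| "csm_lhs D (ChargeNonneg s t) = (\<lambda>x. charge x s t)"
| "csm_lhs D (DischargeNonneg s t) = (\<lambda>x. discharge x s t)"
| "csm_lhs D (EnergyMax s t) = (\<lambda>x. energy_at x s t)"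
| "csm_lhs D (EnergyMin s t) = (\<lambda>x. energy_at x s t)"
| "csm_lhs D (DualGen g t) = (\<lambda>x.
     gam_p x g t + gam_m x g t + (\<Sum>i\<in>{i \<in> nodes D. g \<in> gens_at D i}. price x i t))"
| "csm_lhs D (DualFlow l t) = (\<lambda>x.
     - zeta x l t + rho_p x l t + rho_m x l t - price x (fst l) t + price x (snd l) t)"
| "csm_lhs D (DualAngle i t) = (\<lambda>x.
     (\<Sum>l\<in>lines_from D i. admittance D l * zeta x l t)
     - (\<Sum>l\<in>lines_to D i. admittance D l * zeta x l t))"
| "csm_lhs D (DualCharge s t) = (\<lambda>x.
     - (\<Sum>i\<in>{i \<in> nodes D. s \<in> stores_at D i}. price x i t)
     + eff D * alpha_at D x s t + tau_p x s t)"
| "csm_lhs D (DualDischarge s t) = (\<lambda>x.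
     (\<Sum>i\<in>{i \<in> nodes D. s \<in> stores_at D i}. price x i t)
     - 1 / eff D * alpha_at D x s t + tau_m x s t)"
| "csm_lhs D (DualEnergy s t) = (\<lambda>x.
     beta_p x s t + beta_m x s t + alpha_at D x s t - alpha_at D x s (t - 1))"
| "csm_lhs D (RhoPSign l t) = (\<lambda>x. rho_p x l t)"
| "csm_lhs D (RhoMSign l t) = (\<lambda>x. rho_m x l t)"
| "csm_lhs D (GamPSign g t) = (\<lambda>x. gam_p x g t)"
| "csm_lhs D (GamMSign g t) = (\<lambda>x. gam_m x g t)"
| "csm_lhs D (BetaPSign s t) = (\<lambda>x. beta_p x s t)"
| "csm_lhs D (BetaMSign s t) = (\<lambda>x. beta_m x s t)"
| "csm_lhs D (TauPSign s t) = (\<lambda>x. tau_p x s t)"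
| "csm_lhs D (TauMSign s t) = (\<lambda>x. tau_m x s t)"
| "csm_lhs D StrongDuality = (\<lambda>x.
     (\<Sum>t\<in>periods D.
        (\<Sum>g\<in>gens D. cost D g * gen x g t)
        - (\<Sum>i\<in>nodes D. demand D i t * price x i t)
        - (\<Sum>l\<in>lines D. (rho_p x l t - rho_m x l t) * fmax D l)
        - (\<Sum>g\<in>gens D. gam_p x g t * pmax D g + gam_m x g t * pmin D g))
     - (\<Sum>s\<in>stores D. \<Sum>t\<in>sto_periods D. beta_p x s t * emax D s))"

definition csm ::
  "('n, 'g, 's) grid \<Rightarrow> (('n, 'g, 's) con, ('n, 'g, 's) csm_vars) program" where
  "csm D = \<lparr>constrs = {k. csm_index D k}, lhs = csm_lhs D, sense_of = csm_sense,
     rhs = csm_rhs D,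
     objective = (\<lambda>x. \<Sum>t\<in>periods D. \<Sum>g\<in>gens D. emission D g * gen x g t)\<rparr>"

text \<open>The sum in the Lagrangian is over a finite set, so it is not the default value \<open>0\<close>.\<close>

lemma finite_constrs_csm:
  assumes "valid_grid D"
  shows "finite (constrs (csm D))"
proof -
  have fin: "finite (nodes D)" "finite (gens D)" "finite (stores D)" "finite (lines D)"
    using assms by (auto simp: valid_grid_def intro: finite_subset)
  let ?T = "{1..num_periods D + 1}"
  let ?im = "\<lambda>C A. (\<lambda>(a, t). C a t) ` (A \<times> ?T)"
  have "constrs (csm D) \<subseteq>
    insert StrongDuality
     ((\<Union>C\<in>{Ohm, FlowMax, FlowMin, DualFlow, RhoPSign, RhoMSign}. ?im C (lines D))
      \<union> (\<Union>C\<in>{Balance, DualAngle}. ?im C (nodes D))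
      \<union> (\<Union>C\<in>{GenMax, GenMin, DualGen, GamPSign, GamMSign}. ?im C (gens D))
      \<union> (\<Union>C\<in>{StoreDynamics, ChargeNonneg, DischargeNonneg, EnergyMax, EnergyMin,
             DualCharge, DualDischarge, DualEnergy, BetaPSign, BetaMSign, TauPSign, TauMSign}.
           ?im C (stores D)))"
    (is "_ \<subseteq> ?R")
  proof
    fix k assume "k \<in> constrs (csm D)"
    then have "csm_index D k" by (simp add: csm_def)
    then show "k \<in> ?R"
      by (cases k) (auto simp: periods_def sto_periods_def image_iff)
  qed
  moreover have "finite ?R" using fin by simp
  ultimately show ?thesis by (rule finite_subset)
qed

section \<open>Carbon accounting prices\<close>

definition LME ::
  "('n, 'g, 's) csm_vars \<Rightarrow> (('n, 'g, 's) con \<Rightarrow> real) \<Rightarrow> 'n \<Rightarrow> nat \<Rightarrow> real" where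
  "LME x p i t = p (Balance i t) + p StrongDuality * price x i t"

definition SCI ::
  "('n, 'g, 's) csm_vars \<Rightarrow> (('n, 'g, 's) con \<Rightarrow> real) \<Rightarrow> 'n \<times> 'n \<Rightarrow> nat \<Rightarrow> real" where
  "SCI x p l t = p (FlowMax l t) - p (FlowMin l t)
     + p StrongDuality * (rho_p x l t - rho_m x l t)"

end

theory Submission
  imports Defs
begin

text \<open>
  Why the accounts add up. Weighting the nodal balances by the prices \<open>LME\<close> and summing over
  nodes expresses the account of the loads through the generation and storage terms, minus
  \<open>\<Sum> (LME\<^sub>i - LME\<^sub>j) f\<close> over the lines \<open>(i, j)\<close> (\<open>weighted_balance\<close>). The generation and storage
  terms cancel against those of the claim, so what remains to be shown is that the line accounts
  \<open>\<Sum> SCI \<bar>f\<bar>\<close> equal this price-difference sum over all lines and periods. \<open>LME\<close> is a sum of two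
  nodal prices, the multiplier of the balance and \<open>p\<^sub>o\<close> times the inner price \<open>\<pi>\<close>, and each part is
  treated by the same two steps.

  First, price differences become congestion prices. For \<open>\<pi>\<close> this is the dual feasibility
  contained in the model: the variables \<open>z\<close>, dual to Ohm's law, drop out because flows
  derived from angles are orthogonal to them (\<open>price_differences\<close>). For the multipliers it is stationarity of the
  Lagrangian along one direction only, namely scaling all flows and angles together; Ohm's law is
  invariant under this scaling, so only the balances and the flow limits contribute
  (\<open>balance_multiplier_differences\<close>).

  Second, complementary slackness turns \<open>(u\<^sup>+ + u\<^sup>-) f\<close> into \<open>(u\<^sup>+ - u\<^sup>-) \<bar>f\<bar>\<close>, since a nonzero
  congestion price fixes the direction of the flow (\<open>slack_pair_times_flow\<close>). For the inner prices
  the slackness holds because the strong duality constraint bounds by zero a sum of products that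
  are all nonnegative (\<open>duality_gap_as_slack\<close>).

  Slackness and stationarity for the multipliers rest on linear programming duality, which
  is derived here for abstract programs from a version of Farkas' lemma.
\<close>

section \<open>Linear programming duality\<close>

lemma sign_ok_mult_nonneg:
  assumes "sign_ok s q" "holds s a b"
  shows "0 \<le> q * (a - b)"
  using assms by (cases s) (simp_all add: zero_le_mult_iff)

text \<open>
  Farkas' lemma, by induction on the number of constraints. If the last constraint \<open>j\<close> cannot be
  dropped, some \<open>u\<close> satisfies all the others and has \<open>\<psi> u < 0\<close>, so that it violates \<open>j\<close>. Projecting
  along \<open>u\<close> onto the kernel of \<open>\<phi> j\<close> and applying the induction hypothesis there gives the other
  coefficients; the value at \<open>u\<close> then determines the coefficient of \<open>j\<close>, and its sign comes out
  right because \<open>u\<close> violates \<open>j\<close>. Points enter only through the values of the functionals, and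
  linear combinations are asked of these values only, so the lemma applies to points that are
  records.
\<close>

lemma farkas_senses:
  fixes \<phi> :: "'c \<Rightarrow> 'x \<Rightarrow> real" and \<psi> :: "'x \<Rightarrow> real"
  assumes "finite K"
    and "\<And>x y a. x \<in> X \<Longrightarrow> y \<in> X \<Longrightarrow>
           \<exists>z\<in>X. (\<forall>k\<in>K. \<phi> k z = \<phi> k x + a * \<phi> k y) \<and> \<psi> z = \<psi> x + a * \<psi> y"
    and "\<And>x. x \<in> X \<Longrightarrow> \<forall>k\<in>K. holds (s k) (\<phi> k x) 0 \<Longrightarrow> 0 \<le> \<psi> x"
  shows "\<exists>q. (\<forall>k\<in>K. sign_ok (s k) (q k)) \<and> (\<forall>x\<in>X. \<psi> x = (\<Sum>k\<in>K. q k * \<phi> k x))"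
  using assms
proof (induction K arbitrary: X rule: finite_induct)
  case empty
  have "\<psi> x = 0" if x: "x \<in> X" for x
  proof -
    (* The coefficient -2 makes z the negative of x, so \<psi> is nonnegative at both. *)
    obtain z where "z \<in> X" "\<psi> z = \<psi> x + (-2) * \<psi> x"
      using empty.prems(1)[OF x x, of "-2"] by auto
    then show ?thesis
      using empty.prems(2)[of z] empty.prems(2)[OF x] by auto
  qed
  then show ?case by auto
next
  case (insert j K)
  note comb = insert.prems(1)
  show ?case
  proof (cases "\<exists>u\<in>X. (\<forall>k\<in>K. holds (s k) (\<phi> k u) 0) \<and> \<psi> u < 0")
    case False
    have "\<exists>q. (\<forall>k\<in>K. sign_ok (s k) (q k)) \<and> (\<forall>x\<in>X. \<psi> x = (\<Sum>k\<in>K. q k * \<phi> k x))"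
    proof (rule insert.IH)
      show "\<exists>z\<in>X. (\<forall>k\<in>K. \<phi> k z = \<phi> k x + a * \<phi> k y) \<and> \<psi> z = \<psi> x + a * \<psi> y"
        if "x \<in> X" "y \<in> X" for x y a
        using comb[OF that, of a] by auto
      show "0 \<le> \<psi> x" if "x \<in> X" "\<forall>k\<in>K. holds (s k) (\<phi> k x) 0" for x
        using False that by force
    qed
    then obtain q where q: "\<forall>k\<in>K. sign_ok (s k) (q k)" "\<forall>x\<in>X. \<psi> x = (\<Sum>k\<in>K. q k * \<phi> k x)"
      by blast
    have "sign_ok (s j) 0" by (cases "s j") auto
    moreover have "(\<Sum>k\<in>insert j K. (q(j := 0)) k * \<phi> k x) = (\<Sum>k\<in>K. q k * \<phi> k x)" for x
      using insert.hyps by (auto intro!: sum.cong)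
    ultimately show ?thesis
      using q insert.hyps by (intro exI[of _ "q(j := 0)"]) auto
  next
    case True
    then obtain u where u: "u \<in> X" "\<forall>k\<in>K. holds (s k) (\<phi> k u) 0" "\<psi> u < 0"
      by blast
    have uj: "\<not> holds (s j) (\<phi> j u) 0"
      using insert.prems(2)[OF u(1)] u by force
    then have uj0: "\<phi> j u \<noteq> 0" by (cases "s j") auto
    let ?Y = "{x \<in> X. \<phi> j x = 0}"
    have j0: "holds (s j) 0 0" by (cases "s j") auto
    have "\<exists>q. (\<forall>k\<in>K. sign_ok (s k) (q k)) \<and> (\<forall>x\<in>?Y. \<psi> x = (\<Sum>k\<in>K. q k * \<phi> k x))"
    proof (rule insert.IH)
      show "\<exists>z\<in>?Y. (\<forall>k\<in>K. \<phi> k z = \<phi> k x + a * \<phi> k y) \<and> \<psi> z = \<psi> x + a * \<psi> y"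
        if "x \<in> ?Y" "y \<in> ?Y" for x y a
        using comb[of x y a] that by auto
      show "0 \<le> \<psi> x" if "x \<in> ?Y" "\<forall>k\<in>K. holds (s k) (\<phi> k x) 0" for x
        using insert.prems(2)[of x] that j0 by auto
    qed
    then obtain q where q: "\<forall>k\<in>K. sign_ok (s k) (q k)" "\<forall>x\<in>?Y. \<psi> x = (\<Sum>k\<in>K. q k * \<phi> k x)"
      by blast
    (* The only coefficient of j for which the identity also holds at u. *)
    define c where "c = (\<psi> u - (\<Sum>k\<in>K. q k * \<phi> k u)) / \<phi> j u"
    have "0 \<le> (\<Sum>k\<in>K. q k * \<phi> k u)"
      using q(1) u(2) sign_ok_mult_nonneg[where b = 0] by (intro sum_nonneg) fastforce
    then have "\<psi> u - (\<Sum>k\<in>K. q k * \<phi> k u) < 0"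
      using u(3) by linarith
    then have cj: "sign_ok (s j) c"
      using uj by (cases "s j") (auto simp: c_def divide_nonpos_pos divide_nonpos_neg)
    have "\<psi> x = (\<Sum>k\<in>K. q k * \<phi> k x) + c * \<phi> j x" if x: "x \<in> X" for x
    proof -
      let ?a = "- \<phi> j x / \<phi> j u"
      obtain z where z: "z \<in> X" "\<forall>k\<in>insert j K. \<phi> k z = \<phi> k x + ?a * \<phi> k u"
        "\<psi> z = \<psi> x + ?a * \<psi> u"
        using comb[OF x u(1), of ?a] by blast
      have "z \<in> ?Y" using z uj0 by auto
      then have "\<psi> x + ?a * \<psi> u = (\<Sum>k\<in>K. q k * \<phi> k z)"
        using q(2) z(3) by auto
      also have "\<dots> = (\<Sum>k\<in>K. q k * \<phi> k x + ?a * (q k * \<phi> k u))"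
      proof (rule sum.cong[OF refl])
        fix k assume "k \<in> K"
        then have "\<phi> k z = \<phi> k x + ?a * \<phi> k u" using z(2) by blast
        then show "q k * \<phi> k z = q k * \<phi> k x + ?a * (q k * \<phi> k u)"
          by (simp only: distrib_left mult.left_commute)
      qed
      also have "\<dots> = (\<Sum>k\<in>K. q k * \<phi> k x) + ?a * (\<Sum>k\<in>K. q k * \<phi> k u)"
        by (simp only: sum.distrib sum_distrib_left)
      finally show ?thesis
        using uj0 unfolding c_def by (simp add: field_simps)
    qed
    moreover have "(\<Sum>k\<in>insert j K. (q(j := c)) k * \<phi> k x) = (\<Sum>k\<in>K. q k * \<phi> k x) + c * \<phi> j x"
      for x
      using insert.hyps by (auto intro!: sum.cong)
    ultimately show ?thesis
      using q(1) cj insert.hyps by (intro exI[of _ "q(j := c)"]) auto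
  qed
qed

text \<open>
  This says that the values of all constraints and of the objective form an affine space. It
  replaces linearity in the variables where the type of points carries no linear structure.
\<close>

definition affine_program :: "('c, 'x) program \<Rightarrow> bool" where
  "affine_program P \<longleftrightarrow> (\<forall>x y y' a. \<exists>z.
     (\<forall>k\<in>constrs P. lhs P k z = lhs P k x + a * (lhs P k y' - lhs P k y)) \<and>
     objective P z = objective P x + a * (objective P y' - objective P y))"

lemma affine_programE:
  assumes "affine_program P"
  obtains z where "\<forall>k\<in>constrs P. lhs P k z = lhs P k x + a * (lhs P k y' - lhs P k y)"
    "objective P z = objective P x + a * (objective P y' - objective P y)"
  using assms unfolding affine_program_def by blast

text \<open>
  Constraints that are strict at \<open>x\<close> stay satisfied for a small step towards \<open>y\<close>, so only the active
  ones can prevent descent.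
\<close>

lemma optimal_imp_no_descent_direction:
  assumes fin: "finite (constrs P)" and aff: "affine_program P" and opt: "optimal P x"
    and dir: "\<And>k. k \<in> constrs P \<Longrightarrow> lhs P k x = rhs P k \<Longrightarrow>
                holds (sense_of P k) (lhs P k y - lhs P k x) 0"
  shows "objective P x \<le> objective P y"
proof -
  have feas: "holds (sense_of P k) (lhs P k x) (rhs P k)" if "k \<in> constrs P" for k
    using opt that by (auto simp: optimal_def feasible_def)
  have "\<forall>\<^sub>F \<epsilon> in at_right 0. \<forall>k\<in>constrs P.
          holds (sense_of P k) (lhs P k x + \<epsilon> * (lhs P k y - lhs P k x)) (rhs P k)"
  proof (rule eventually_ball_finite[OF fin], intro ballI)
    fix k assume k: "k \<in> constrs P"
    let ?d = "lhs P k y - lhs P k x"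
    have lim: "((\<lambda>\<epsilon>. lhs P k x + \<epsilon> * ?d) \<longlongrightarrow> lhs P k x) (at_right 0)"
      by (auto intro!: tendsto_eq_intros)
    show "\<forall>\<^sub>F \<epsilon> in at_right 0. holds (sense_of P k) (lhs P k x + \<epsilon> * ?d) (rhs P k)"
    proof (cases "lhs P k x = rhs P k")
      case True
      have "\<forall>\<^sub>F \<epsilon>::real in at_right 0. 0 < \<epsilon>" by (rule eventually_at_right_less)
      then show ?thesis
        by (rule eventually_mono)
          (use dir[OF k True] True in \<open>cases "sense_of P k", auto simp: mult_nonneg_nonpos\<close>)
    next
      case False
      then consider "sense_of P k = LE" "lhs P k x < rhs P k"
        | "sense_of P k = GE" "rhs P k < lhs P k x"
        using feas[OF k] by (cases "sense_of P k") auto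
      then show ?thesis
      proof cases
        case 1
        show ?thesis
          using order_tendstoD(2)[OF lim 1(2)] by eventually_elim (simp add: 1(1))
      next
        case 2
        show ?thesis
          using order_tendstoD(1)[OF lim 2(2)] by eventually_elim (simp add: 2(1))
      qed
    qed
  qed
  then have "\<forall>\<^sub>F \<epsilon> in at_right 0. 0 < \<epsilon> \<and> (\<forall>k\<in>constrs P.
          holds (sense_of P k) (lhs P k x + \<epsilon> * (lhs P k y - lhs P k x)) (rhs P k))"
    by (intro eventually_conj eventually_at_right_less)
  then obtain \<epsilon> :: real where \<epsilon>: "0 < \<epsilon>" "\<forall>k\<in>constrs P.
          holds (sense_of P k) (lhs P k x + \<epsilon> * (lhs P k y - lhs P k x)) (rhs P k)"
    using eventually_happens trivial_limit_at_right_real by blast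
  obtain z where z: "\<forall>k\<in>constrs P. lhs P k z = lhs P k x + \<epsilon> * (lhs P k y - lhs P k x)"
    "objective P z = objective P x + \<epsilon> * (objective P y - objective P x)"
    using affine_programE[OF aff] .
  have "feasible P z" using \<epsilon>(2) z(1) by (simp add: feasible_def)
  then have "0 \<le> \<epsilon> * (objective P y - objective P x)"
    using opt z(2) by (force simp: optimal_def)
  then show ?thesis using \<epsilon>(1) by (simp add: zero_le_mult_iff)
qed

text \<open>
  Farkas' lemma applied to the active constraints writes the change of the objective as a signed
  combination of the changes of these constraints, which means that the Lagrangian is constant.
\<close>

lemma strong_duality:
  assumes fin: "finite (constrs P)" and aff: "affine_program P" and opt: "optimal P x"
  shows "\<exists>q. dual_feasible P q \<and> (\<forall>y. lagrangian P y q = objective P x)"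
proof -
  let ?A = "{k \<in> constrs P. lhs P k x = rhs P k}"
  have "\<exists>q. (\<forall>k\<in>?A. sign_ok (sense_of P k) (q k)) \<and>
     (\<forall>y\<in>UNIV. objective P y - objective P x = (\<Sum>k\<in>?A. q k * (lhs P k y - lhs P k x)))"
  proof (rule farkas_senses)
    show "finite ?A" using fin by simp
    show "\<exists>w\<in>UNIV. (\<forall>k\<in>?A. lhs P k w - lhs P k x =
              lhs P k y - lhs P k x + a * (lhs P k z - lhs P k x)) \<and>
            objective P w - objective P x =
              objective P y - objective P x + a * (objective P z - objective P x)" for y z a
    proof -
      obtain w where "\<forall>k\<in>constrs P. lhs P k w = lhs P k y + a * (lhs P k z - lhs P k x)"
        "objective P w = objective P y + a * (objective P z - objective P x)"
        using affine_programE[OF aff] .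
      then show ?thesis by (intro bexI[of _ w]) auto
    qed
    show "0 \<le> objective P y - objective P x"
      if "\<forall>k\<in>?A. holds (sense_of P k) (lhs P k y - lhs P k x) 0" for y
      using optimal_imp_no_descent_direction[OF fin aff opt, of y] that by auto
  qed
  then obtain q where q: "\<forall>k\<in>?A. sign_ok (sense_of P k) (q k)"
    "\<And>y. objective P y - objective P x = (\<Sum>k\<in>?A. q k * (lhs P k y - lhs P k x))"
    by blast
  (* Inactive constraints get the multiplier zero. *)
  define r where "r k = (if k \<in> ?A then q k else 0)" for k
  have "sign_ok s 0" for s by (cases s) auto
  then have "dual_feasible P r"
    using q(1) by (auto simp: dual_feasible_def r_def)
  moreover have "lagrangian P y r = objective P x" for y
  proof -
    have "(\<Sum>k\<in>constrs P. r k * (lhs P k y - rhs P k)) = (\<Sum>k\<in>?A. q k * (lhs P k y - lhs P k x))"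
      by (rule sum.mono_neutral_cong_right) (use fin in \<open>auto simp: r_def\<close>)
    then show ?thesis using q(2)[of y] by (simp add: lagrangian_def)
  qed
  ultimately show ?thesis by blast
qed

text \<open>
  By strong duality, the Lagrangian of a dual optimal \<open>p\<close> is bounded below by the optimal value.
  At \<open>x\<close> it is at most that value, which leaves no room for a nonzero slackness product; and an
  affine function that attains its lower bound is constant.
\<close>

lemma dual_optimal_saddle:
  assumes fin: "finite (constrs P)" and aff: "affine_program P"
    and opt: "optimal P x" and dual: "dual_optimal P p"
  shows complementary_slackness: "k \<in> constrs P \<Longrightarrow> p k * (lhs P k x - rhs P k) = 0"
    and lagrangian_constant: "lagrangian P y p = objective P x"
proof -
  obtain q where q: "dual_feasible P q" "\<And>y. lagrangian P y q = objective P x"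
    using strong_duality[OF fin aff opt] by blast
  have "ereal (objective P x) \<le> dual_function P q"
    by (simp add: dual_function_def q(2))
  also have "\<dots> \<le> dual_function P p"
    using dual q(1) by (simp add: dual_optimal_def)
  finally have ge: "objective P x \<le> lagrangian P y p" for y
    unfolding dual_function_def by (simp add: le_INF_iff)
  have nn: "0 \<le> p k * (lhs P k x - rhs P k)" if "k \<in> constrs P" for k
    using that dual opt
    by (intro sign_ok_mult_nonneg[of "sense_of P k"])
      (auto simp: dual_optimal_def dual_feasible_def optimal_def feasible_def)
  have "(\<Sum>k\<in>constrs P. p k * (lhs P k x - rhs P k)) = 0"
    using ge[of x] sum_nonneg[of "constrs P" "\<lambda>k. p k * (lhs P k x - rhs P k)", OF nn]
    unfolding lagrangian_def by linarith
  then show slack: "p k * (lhs P k x - rhs P k) = 0" if "k \<in> constrs P" for k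
    using sum_nonneg_eq_0_iff[of "constrs P" "\<lambda>k. p k * (lhs P k x - rhs P k)", OF fin nn] that
    by simp
  have Lx: "lagrangian P x p = objective P x"
    by (simp add: lagrangian_def slack)
  (* z is the reflection of y in x: if the Lagrangian exceeded its minimum at y, it would
     fall below it at z. *)
  obtain z where z: "\<forall>k\<in>constrs P. lhs P k z = lhs P k x + (-1) * (lhs P k y - lhs P k x)"
    "objective P z = objective P x + (-1) * (objective P y - objective P x)"
    using affine_programE[OF aff] .
  have "(\<Sum>k\<in>constrs P. p k * (lhs P k z - rhs P k)) =
    (\<Sum>k\<in>constrs P. 2 * (p k * (lhs P k x - rhs P k)) - p k * (lhs P k y - rhs P k))"
  proof (rule sum.cong[OF refl])
    fix k assume "k \<in> constrs P"
    then have zk: "lhs P k z = 2 * lhs P k x - lhs P k y" using z(1) by auto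
    show "p k * (lhs P k z - rhs P k) =
        2 * (p k * (lhs P k x - rhs P k)) - p k * (lhs P k y - rhs P k)"
      unfolding zk by (simp add: algebra_simps)
  qed
  then have "lagrangian P z p = 2 * lagrangian P x p - lagrangian P y p"
    using z(2) by (simp add: lagrangian_def sum_subtractf sum_distrib_left)
  then show "lagrangian P y p = objective P x"
    using ge[of z] ge[of y] Lx by simp
qed

section \<open>The combined storage model as a linear program\<close>

lemma affine_csm:
  fixes D :: "('n, 'g, 's) grid"
  shows "affine_program (csm D)"
  unfolding affine_program_def
proof (intro allI)
  fix x y y' :: "('n, 'g, 's) csm_vars" and a :: real
  (* The same term four times, at the four index types: an abbreviation is monomorphic. *)
  let ?n = "\<lambda>F i t. F x i t + a * (F y' i t - F y i t)"
  let ?g = "\<lambda>F i t. F x i t + a * (F y' i t - F y i t)"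
  let ?s = "\<lambda>F i t. F x i t + a * (F y' i t - F y i t)"
  let ?l = "\<lambda>F i t. F x i t + a * (F y' i t - F y i t)"
  obtain z :: "('n, 'g, 's) csm_vars" where z:
    "gen z = ?g gen" "angle z = ?n angle" "flow z = ?l flow" "charge z = ?s charge"
    "discharge z = ?s discharge" "energy z = ?s energy" "price z = ?n price"
    "gam_p z = ?g gam_p" "gam_m z = ?g gam_m" "rho_p z = ?l rho_p" "rho_m z = ?l rho_m"
    "zeta z = ?l zeta" "alpha z = ?s alpha" "beta_p z = ?s beta_p" "beta_m z = ?s beta_m"
    "tau_p z = ?s tau_p" "tau_m z = ?s tau_m"
    by (rule that[of "\<lparr>gen = ?g gen, angle = ?n angle, flow = ?l flow, charge = ?s charge,
      discharge = ?s discharge, energy = ?s energy, price = ?n price,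
      gam_p = ?g gam_p, gam_m = ?g gam_m, rho_p = ?l rho_p, rho_m = ?l rho_m,
      zeta = ?l zeta, alpha = ?s alpha, beta_p = ?s beta_p, beta_m = ?s beta_m,
      tau_p = ?s tau_p, tau_m = ?s tau_m\<rparr>"]) (rule csm_vars.select_convs)+
  have en: "energy_at z s t = ?s energy_at s t" for s t
    by (simp add: energy_at_def z)
  have al: "alpha_at D z s t = ?s (alpha_at D) s t" for s t
    by (simp add: alpha_at_def z)
  (* The functionals affine at z are closed under all operations that build the constraints,
     which avoids normalising the large sums. *)
  define A where "A F \<longleftrightarrow> F z = F x + a * (F y' - F y)" for F :: "('n, 'g, 's) csm_vars \<Rightarrow> real"
  have base: "A (\<lambda>v. gen v g t)" "A (\<lambda>v. angle v i t)" "A (\<lambda>v. flow v l t)"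
    "A (\<lambda>v. charge v s t)" "A (\<lambda>v. discharge v s t)" "A (\<lambda>v. energy_at v s t)"
    "A (\<lambda>v. price v i t)" "A (\<lambda>v. gam_p v g t)" "A (\<lambda>v. gam_m v g t)"
    "A (\<lambda>v. rho_p v l t)" "A (\<lambda>v. rho_m v l t)" "A (\<lambda>v. zeta v l t)"
    "A (\<lambda>v. alpha_at D v s t)" "A (\<lambda>v. beta_p v s t)" "A (\<lambda>v. beta_m v s t)"
    "A (\<lambda>v. tau_p v s t)" "A (\<lambda>v. tau_m v s t)" for g i l s t
    by (simp_all add: A_def z en al)
  have add: "A (\<lambda>v. F v + G v)" and diff: "A (\<lambda>v. F v - G v)" if "A F" "A G" for F G
    using that by (simp_all add: A_def right_diff_distrib distrib_left)
  have uminus: "A (\<lambda>v. - F v)" and scale: "A (\<lambda>v. c * F v)" and scale': "A (\<lambda>v. F v * c)"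
    if "A F" for F c
    using that by (simp_all add: A_def right_diff_distrib distrib_left distrib_right mult_ac)
  have sum: "A (\<lambda>v. \<Sum>i\<in>I. F i v)" if "\<And>i. A (F i)" for F and I :: "'i set"
    using that by (simp add: A_def sum.distrib sum_subtractf sum_distrib_left right_diff_distrib)
  note intros = base add diff uminus scale scale' sum
  have "A (csm_lhs D k)" for k
    by (cases k) (simp_all only: csm_lhs.simps, (intro intros)+)
  moreover have "A (objective (csm D))"
    by (simp only: csm_def program.select_convs) (intro intros)
  ultimately show "\<exists>z. (\<forall>k\<in>constrs (csm D).
        lhs (csm D) k z = lhs (csm D) k x + a * (lhs (csm D) k y' - lhs (csm D) k y)) \<and>
      objective (csm D) z = objective (csm D) x + a * (objective (csm D) y' - objective (csm D) y)"
    by (intro exI[of _ z]) (simp add: A_def csm_def)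
qed

lemma feasible_csmD:
  assumes "feasible (csm D) x" "csm_index D k"
  shows "holds (csm_sense k) (csm_lhs D k x) (csm_rhs D k)"
  using assms by (simp add: feasible_def csm_def)

section \<open>Weighted sums of the nodal balances\<close>

lemma sum_over_fibres:
  fixes c h :: "_ \<Rightarrow> real"
  assumes "finite A" "finite B" "f ` A \<subseteq> B"
  shows "(\<Sum>b\<in>B. c b * (\<Sum>x\<in>{x\<in>A. f x = b}. h x)) = (\<Sum>x\<in>A. c (f x) * h x)"
proof -
  have "(\<Sum>b\<in>B. c b * (\<Sum>x\<in>{x\<in>A. f x = b}. h x)) =
      (\<Sum>b\<in>B. \<Sum>x\<in>{x\<in>A. f x = b}. c (f x) * h x)"
    by (simp add: sum_distrib_left)
  also have "\<dots> = (\<Sum>x\<in>A. c (f x) * h x)"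
    using assms by (rule sum.group)
  finally show ?thesis .
qed

lemma valid_gridD:
  assumes "valid_grid D"
  shows "finite (nodes D)" "finite (gens D)" "finite (stores D)" "finite (lines D)"
    "gen_node D ` gens D \<subseteq> nodes D" "sto_node D ` stores D \<subseteq> nodes D"
    "fst ` lines D \<subseteq> nodes D" "snd ` lines D \<subseteq> nodes D"
  using assms by (auto simp: valid_grid_def intro: finite_subset)

text \<open>Summation by parts on the network: divergence is adjoint to the difference along lines.\<close>

lemma sum_net_export:
  fixes c h :: "_ \<Rightarrow> real"
  assumes "valid_grid D"
  shows "(\<Sum>i\<in>nodes D. c i * ((\<Sum>l\<in>lines_from D i. h l) - (\<Sum>l\<in>lines_to D i. h l))) =
    (\<Sum>l\<in>lines D. (c (fst l) - c (snd l)) * h l)"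
proof -
  note v = valid_gridD[OF assms]
  show ?thesis
    unfolding lines_from_def lines_to_def right_diff_distrib left_diff_distrib sum_subtractf
      sum_over_fibres[OF v(4,1,7)] sum_over_fibres[OF v(4,1,8)] ..
qed

lemma weighted_balance:
  assumes valid: "valid_grid D" and feas: "feasible (csm D) x" and t: "t \<in> periods D"
  shows "(\<Sum>i\<in>nodes D. c i * demand D i t) =
    (\<Sum>g\<in>gens D. c (gen_node D g) * gen x g t)
    - (\<Sum>l\<in>lines D. (c (fst l) - c (snd l)) * flow x l t)
    - (\<Sum>s\<in>stores D. c (sto_node D s) * (charge x s t - discharge x s t))"
proof -
  note v = valid_gridD[OF valid]
  have bal: "demand D i t = (\<Sum>g\<in>gens_at D i. gen x g t)
      - ((\<Sum>l\<in>lines_from D i. flow x l t) - (\<Sum>l\<in>lines_to D i. flow x l t))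
      - (\<Sum>s\<in>stores_at D i. charge x s t - discharge x s t)" if "i \<in> nodes D" for i
    using feasible_csmD[OF feas, of "Balance i t"] that t by simp
  have "(\<Sum>i\<in>nodes D. c i * demand D i t) =
      (\<Sum>i\<in>nodes D. c i * (\<Sum>g\<in>gens_at D i. gen x g t))
      - (\<Sum>i\<in>nodes D. c i * ((\<Sum>l\<in>lines_from D i. flow x l t) - (\<Sum>l\<in>lines_to D i. flow x l t)))
      - (\<Sum>i\<in>nodes D. c i * (\<Sum>s\<in>stores_at D i. charge x s t - discharge x s t))"
    unfolding sum_subtractf[symmetric] right_diff_distrib[symmetric]
    by (rule sum.cong) (simp_all only: bal)
  then show ?thesis
    unfolding gens_at_def stores_at_def sum_net_export[OF valid]
      sum_over_fibres[OF v(2,1,5)] sum_over_fibres[OF v(3,1,6)] .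
qed

section \<open>Complementary slackness between the dispatch and its prices\<close>

text \<open>
  The dual constraint of the flow gives \<open>\<pi>\<^sub>i - \<pi>\<^sub>j = \<rho>\<^sup>+ + \<rho>\<^sup>- - z\<close>. The contribution of \<open>z\<close> vanishes:
  by Ohm's law \<open>\<Sum> z f\<close> pairs the angle differences with \<open>B z\<close>, whose divergence is zero by the dual
  constraint of the angle.
\<close>

lemma price_differences:
  assumes valid: "valid_grid D" and feas: "feasible (csm D) x" and t: "t \<in> periods D"
  shows "(\<Sum>l\<in>lines D. (price x (fst l) t - price x (snd l) t) * flow x l t) =
    (\<Sum>l\<in>lines D. (rho_p x l t + rho_m x l t) * flow x l t)"
proof -
  let ?Bz = "\<lambda>l. admittance D l * zeta x l t"
  have ohm: "flow x l t = admittance D l * (angle x (fst l) t - angle x (snd l) t)"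
    and df: "price x (fst l) t - price x (snd l) t = rho_p x l t + rho_m x l t - zeta x l t"
    if "l \<in> lines D" for l
    using feasible_csmD[OF feas, of "Ohm l t"] feasible_csmD[OF feas, of "DualFlow l t"] that t
    by simp_all
  have "(\<Sum>l\<in>lines D. zeta x l t * flow x l t) =
      (\<Sum>l\<in>lines D. (angle x (fst l) t - angle x (snd l) t) * ?Bz l)"
    by (rule sum.cong) (simp_all add: ohm mult_ac)
  also have "\<dots> = (\<Sum>i\<in>nodes D. angle x i t *
      ((\<Sum>l\<in>lines_from D i. ?Bz l) - (\<Sum>l\<in>lines_to D i. ?Bz l)))"
    by (simp only: sum_net_export[OF valid])
  also have "\<dots> = 0"
  proof (rule sum.neutral, intro ballI)
    fix i assume "i \<in> nodes D"
    then show "angle x i t * ((\<Sum>l\<in>lines_from D i. ?Bz l) - (\<Sum>l\<in>lines_to D i. ?Bz l)) = 0"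
      using feasible_csmD[OF feas, of "DualAngle i t"] t by simp
  qed
  finally have "(\<Sum>l\<in>lines D. zeta x l t * flow x l t) = 0" .
  moreover have "(\<Sum>l\<in>lines D. (price x (fst l) t - price x (snd l) t) * flow x l t) =
      (\<Sum>l\<in>lines D. (rho_p x l t + rho_m x l t) * flow x l t - zeta x l t * flow x l t)"
    by (rule sum.cong) (simp_all only: df left_diff_distrib)
  ultimately show ?thesis by (simp add: sum_subtractf)
qed

lemma sum_by_parts:
  fixes a E :: "nat \<Rightarrow> real"
  shows "(\<Sum>t\<in>{1..m}. a t * (E (t + 1) - E t)) =
    a (m + 1) * E (m + 1) - a 1 * E 1 + (\<Sum>t\<in>{2..m + 1}. (a (t - 1) - a t) * E t)"
  by (induction m) (simp_all add: algebra_simps)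

text \<open>
  The dual constraints give \<open>\<pi> = \<eta> \<alpha> + \<tau>\<^sup>+\<close>, used for charging, and \<open>\<pi> = \<alpha> / \<eta> - \<tau>\<^sup>-\<close>, used for
  discharging, so the payment is \<open>\<alpha>\<close> times the change of energy, up to the \<open>\<tau>\<close> terms. Summation by
  parts moves the difference from the energy to \<open>\<alpha>\<close>, where it is \<open>\<beta>\<^sup>+ + \<beta>\<^sup>-\<close>. The boundary terms
  vanish because the initial energy and the terminal \<open>\<alpha>\<close> are zero.
\<close>

lemma storage_arbitrage_value:
  assumes valid: "valid_grid D" and feas: "feasible (csm D) x" and s: "s \<in> stores D"
  shows "(\<Sum>t\<in>periods D. price x (sto_node D s) t * (charge x s t - discharge x s t)) =
    (\<Sum>t\<in>periods D. tau_p x s t * charge x s t + tau_m x s t * discharge x s t)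
    + (\<Sum>t\<in>sto_periods D. (beta_p x s t + beta_m x s t) * energy_at x s t)"
proof -
  let ?\<alpha> = "alpha_at D x s" and ?E = "energy_at x s" and ?m = "num_periods D"
  have boundary: "?\<alpha> (?m + 1) = 0" "?E 1 = 0"
    by (simp_all add: alpha_at_def energy_at_def)
  have node: "{i \<in> nodes D. s \<in> stores_at D i} = {sto_node D s}"
    using valid_gridD(6)[OF valid] s by (auto simp: stores_at_def)
  have "price x (sto_node D s) t * (charge x s t - discharge x s t) =
      (tau_p x s t * charge x s t + tau_m x s t * discharge x s t) + ?\<alpha> t * (?E (t + 1) - ?E t)"
    if t: "t \<in> periods D" for t
  proof -
    have c: "price x (sto_node D s) t = eff D * ?\<alpha> t + tau_p x s t"
      using feasible_csmD[OF feas, of "DualCharge s t"] s t by (simp add: node)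
    have d: "price x (sto_node D s) t = 1 / eff D * ?\<alpha> t - tau_m x s t"
      using feasible_csmD[OF feas, of "DualDischarge s t"] s t by (simp add: node)
    have e: "?E (t + 1) - ?E t = eff D * charge x s t - 1 / eff D * discharge x s t"
      using feasible_csmD[OF feas, of "StoreDynamics s t"] s t by simp
    have "price x (sto_node D s) t * (charge x s t - discharge x s t) =
        price x (sto_node D s) t * charge x s t - price x (sto_node D s) t * discharge x s t"
      by (rule right_diff_distrib)
    also have "\<dots> = (eff D * ?\<alpha> t + tau_p x s t) * charge x s t
        - (1 / eff D * ?\<alpha> t - tau_m x s t) * discharge x s t"
      by (subst (1) c, subst (1) d) (rule refl)
    finally show ?thesis
      unfolding e by (simp add: algebra_simps)
  qed
  then have "(\<Sum>t\<in>periods D. price x (sto_node D s) t * (charge x s t - discharge x s t)) =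
      (\<Sum>t\<in>periods D. tau_p x s t * charge x s t + tau_m x s t * discharge x s t)
      + (\<Sum>t\<in>periods D. ?\<alpha> t * (?E (t + 1) - ?E t))"
    by (simp add: sum.distrib)
  also have "(\<Sum>t\<in>periods D. ?\<alpha> t * (?E (t + 1) - ?E t)) =
      (\<Sum>t\<in>sto_periods D. (?\<alpha> (t - 1) - ?\<alpha> t) * ?E t)"
    using sum_by_parts[of ?\<alpha> ?E ?m] boundary unfolding periods_def sto_periods_def by simp
  also have "\<dots> = (\<Sum>t\<in>sto_periods D. (beta_p x s t + beta_m x s t) * ?E t)"
  proof (rule sum.cong[OF refl])
    fix t assume "t \<in> sto_periods D"
    then have "?\<alpha> (t - 1) - ?\<alpha> t = beta_p x s t + beta_m x s t"
      using feasible_csmD[OF feas, of "DualEnergy s t"] s by simp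
    then show "(?\<alpha> (t - 1) - ?\<alpha> t) * ?E t = (beta_p x s t + beta_m x s t) * ?E t"
      by (rule arg_cong)
  qed
  finally show ?thesis .
qed

text \<open>
  Weak duality of the storage DC-OPF in the form of an identity. Every product on the right is
  nonnegative at a feasible point, so the strong duality constraint forces each of them to be zero.
\<close>

lemma duality_gap_as_slack:
  assumes valid: "valid_grid D" and feas: "feasible (csm D) x"
  shows "csm_lhs D StrongDuality x =
    (\<Sum>t\<in>periods D. \<Sum>g\<in>gens D.
        gam_p x g t * (gen x g t - pmax D g) + gam_m x g t * (gen x g t - pmin D g))
    + (\<Sum>t\<in>periods D. \<Sum>l\<in>lines D.
        rho_p x l t * (flow x l t - fmax D l) + rho_m x l t * (flow x l t + fmax D l))
    + (\<Sum>s\<in>stores D. \<Sum>t\<in>periods D.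
        tau_p x s t * charge x s t + tau_m x s t * discharge x s t)
    + (\<Sum>s\<in>stores D. \<Sum>t\<in>sto_periods D.
        beta_p x s t * (energy_at x s t - emax D s) + beta_m x s t * energy_at x s t)"
proof -
  have dg: "cost D g = gam_p x g t + gam_m x g t + price x (gen_node D g) t"
    if "g \<in> gens D" "t \<in> periods D" for g t
  proof -
    have "{i \<in> nodes D. g \<in> gens_at D i} = {gen_node D g}"
      using valid_gridD(5)[OF valid] that by (auto simp: gens_at_def)
    then show ?thesis
      using feasible_csmD[OF feas, of "DualGen g t"] that by simp
  qed
  let ?st = "\<lambda>s t. price x (sto_node D s) t * (charge x s t - discharge x s t)"
  have period: "(\<Sum>g\<in>gens D. cost D g * gen x g t)
        - (\<Sum>i\<in>nodes D. demand D i t * price x i t)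
        - (\<Sum>l\<in>lines D. (rho_p x l t - rho_m x l t) * fmax D l)
        - (\<Sum>g\<in>gens D. gam_p x g t * pmax D g + gam_m x g t * pmin D g) =
      (\<Sum>g\<in>gens D. gam_p x g t * (gen x g t - pmax D g) + gam_m x g t * (gen x g t - pmin D g))
      + (\<Sum>l\<in>lines D. rho_p x l t * (flow x l t - fmax D l) + rho_m x l t * (flow x l t + fmax D l))
      + (\<Sum>s\<in>stores D. ?st s t)"
    if t: "t \<in> periods D" for t
  proof -
    have "(\<Sum>g\<in>gens D. cost D g * gen x g t) =
        (\<Sum>g\<in>gens D. (gam_p x g t + gam_m x g t) * gen x g t)
        + (\<Sum>g\<in>gens D. price x (gen_node D g) t * gen x g t)"
      unfolding sum.distrib[symmetric] distrib_right[symmetric]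
      by (rule sum.cong) (simp_all only: dg[OF _ t])
    moreover have "(\<Sum>i\<in>nodes D. demand D i t * price x i t) =
        (\<Sum>g\<in>gens D. price x (gen_node D g) t * gen x g t)
        - (\<Sum>l\<in>lines D. (rho_p x l t + rho_m x l t) * flow x l t) - (\<Sum>s\<in>stores D. ?st s t)"
      using weighted_balance[OF valid feas t, of "\<lambda>i. price x i t"]
        price_differences[OF valid feas t] by (simp only: mult.commute)
    ultimately show ?thesis
      by (simp add: algebra_simps sum.distrib sum_subtractf)
  qed
  have "csm_lhs D StrongDuality x =
      (\<Sum>t\<in>periods D. \<Sum>g\<in>gens D.
        gam_p x g t * (gen x g t - pmax D g) + gam_m x g t * (gen x g t - pmin D g))
      + (\<Sum>t\<in>periods D. \<Sum>l\<in>lines D.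
        rho_p x l t * (flow x l t - fmax D l) + rho_m x l t * (flow x l t + fmax D l))
      + (\<Sum>t\<in>periods D. \<Sum>s\<in>stores D. ?st s t)
      - (\<Sum>s\<in>stores D. \<Sum>t\<in>sto_periods D. beta_p x s t * emax D s)"
    unfolding csm_lhs.simps
    by (subst sum.cong[OF refl[of "periods D"] period]) (simp_all only: sum.distrib)
  also have "(\<Sum>t\<in>periods D. \<Sum>s\<in>stores D. ?st s t) =
      (\<Sum>s\<in>stores D.
        (\<Sum>t\<in>periods D. tau_p x s t * charge x s t + tau_m x s t * discharge x s t)
        + (\<Sum>t\<in>sto_periods D. (beta_p x s t + beta_m x s t) * energy_at x s t))"
    by (subst sum.swap) (simp only: storage_arbitrage_value[OF valid feas] cong: sum.cong)
  finally show ?thesis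
    by (simp add: algebra_simps sum.distrib sum_subtractf)
qed

text \<open>
  The generation, storage and energy sums of the gap are nonnegative, so the line sum is at most
  zero; being a sum of nonnegative products, it has all of them equal to zero.
\<close>

lemma congestion_price_slackness:
  assumes valid: "valid_grid D" and feas: "feasible (csm D) x"
    and l: "l \<in> lines D" and t: "t \<in> periods D"
  shows "rho_p x l t * (flow x l t - fmax D l) = 0"
    and "rho_m x l t * (flow x l t + fmax D l) = 0"
proof -
  note f = feasible_csmD[OF feas]
  let ?G = "\<lambda>g t. gam_p x g t * (gen x g t - pmax D g) + gam_m x g t * (gen x g t - pmin D g)"
  let ?L = "\<lambda>l t. rho_p x l t * (flow x l t - fmax D l) + rho_m x l t * (flow x l t + fmax D l)"
  let ?T = "\<lambda>s t. tau_p x s t * charge x s t + tau_m x s t * discharge x s t"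
  let ?E = "\<lambda>s t. beta_p x s t * (energy_at x s t - emax D s) + beta_m x s t * energy_at x s t"
  have rp: "0 \<le> rho_p x l t * (flow x l t - fmax D l)"
    and rm: "0 \<le> rho_m x l t * (flow x l t + fmax D l)"
    if "l \<in> lines D" "t \<in> periods D" for l t
    using f[of "RhoPSign l t"] f[of "RhoMSign l t"] f[of "FlowMax l t"] f[of "FlowMin l t"] that
    by (simp_all add: zero_le_mult_iff)
  have L: "0 \<le> ?L l t" if "l \<in> lines D" "t \<in> periods D" for l t
    using rp[OF that] rm[OF that] by simp
  have "0 \<le> (\<Sum>t\<in>periods D. \<Sum>g\<in>gens D. ?G g t)"
  proof (intro sum_nonneg add_nonneg_nonneg)
    fix g t assume "g \<in> gens D" "t \<in> periods D"
    then show "0 \<le> gam_p x g t * (gen x g t - pmax D g)" "0 \<le> gam_m x g t * (gen x g t - pmin D g)"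
      using f[of "GamPSign g t"] f[of "GamMSign g t"] f[of "GenMax g t"] f[of "GenMin g t"]
      by (simp_all add: zero_le_mult_iff)
  qed
  moreover have "0 \<le> (\<Sum>s\<in>stores D. \<Sum>t\<in>periods D. ?T s t)"
  proof (intro sum_nonneg add_nonneg_nonneg)
    fix s t assume "s \<in> stores D" "t \<in> periods D"
    then show "0 \<le> tau_p x s t * charge x s t" "0 \<le> tau_m x s t * discharge x s t"
      using f[of "TauPSign s t"] f[of "TauMSign s t"] f[of "ChargeNonneg s t"]
        f[of "DischargeNonneg s t"]
      by simp_all
  qed
  moreover have "0 \<le> (\<Sum>s\<in>stores D. \<Sum>t\<in>sto_periods D. ?E s t)"
  proof (intro sum_nonneg add_nonneg_nonneg)
    fix s t assume "s \<in> stores D" "t \<in> sto_periods D"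
    then show "0 \<le> beta_p x s t * (energy_at x s t - emax D s)" "0 \<le> beta_m x s t * energy_at x s t"
      using f[of "BetaPSign s t"] f[of "BetaMSign s t"] f[of "EnergyMax s t"] f[of "EnergyMin s t"]
      by (simp_all add: zero_le_mult_iff)
  qed
  moreover have "csm_lhs D StrongDuality x \<le> 0"
    using f[of StrongDuality] by (simp del: csm_lhs.simps)
  ultimately have "(\<Sum>t\<in>periods D. \<Sum>l\<in>lines D. ?L l t) \<le> 0"
    unfolding duality_gap_as_slack[OF valid feas] by linarith
  moreover have "?L l t \<le> (\<Sum>l\<in>lines D. ?L l t)"
    by (rule member_le_sum[OF l _ valid_gridD(4)[OF valid]]) (simp add: L t)
  moreover have "(\<Sum>l\<in>lines D. ?L l t) \<le> (\<Sum>t\<in>periods D. \<Sum>l\<in>lines D. ?L l t)"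
    by (rule member_le_sum[OF t]) (use L in \<open>auto simp: periods_def intro!: sum_nonneg\<close>)
  ultimately have "?L l t \<le> 0" by linarith
  then show "rho_p x l t * (flow x l t - fmax D l) = 0" "rho_m x l t * (flow x l t + fmax D l) = 0"
    using rp[OF l t] rm[OF l t] by linarith+
qed

section \<open>Multiplier differences along lines and the carbon accounts\<close>

text \<open>
  The Lagrangian takes the same value at \<open>x\<close> and at the point \<open>y\<close> with all flows and angles set
  to zero. Both points satisfy Ohm's law and agree in everything else except the balances and the
  flow limits, so the multipliers of these constraints account for the whole difference.
\<close>

lemma balance_multiplier_differences:
  assumes valid: "valid_grid D" and opt: "optimal (csm D) x" and dual: "dual_optimal (csm D) p"
  shows "(\<Sum>t\<in>periods D. \<Sum>l\<in>lines D.
      (p (Balance (fst l) t) - p (Balance (snd l) t)) * flow x l t) =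
    (\<Sum>t\<in>periods D. \<Sum>l\<in>lines D. (p (FlowMax l t) + p (FlowMin l t)) * flow x l t)"
proof -
  have feas: "feasible (csm D) x" using opt by (simp add: optimal_def)
  note v = valid_gridD[OF valid]
  have fin: "finite (constrs (csm D))" by (rule finite_constrs_csm[OF valid])
  define y where "y = x\<lparr>flow := \<lambda>_ _. 0, angle := \<lambda>_ _. 0\<rparr>"
  define h where "h k = p k * (csm_lhs D k x - csm_lhs D k y)" for k
  define B where "B = (\<lambda>(t, i). Balance i t :: ('a, 'b, 'c) con) ` (periods D \<times> nodes D)"
  define U where "U = (\<lambda>(t, l). FlowMax l t :: ('a, 'b, 'c) con) ` (periods D \<times> lines D)"
  define V where "V = (\<lambda>(t, l). FlowMin l t :: ('a, 'b, 'c) con) ` (periods D \<times> lines D)"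
  have "lagrangian (csm D) x p = lagrangian (csm D) y p"
    using lagrangian_constant[OF fin affine_csm opt dual] by simp
  moreover have "objective (csm D) y = objective (csm D) x"
    by (simp add: csm_def y_def)
  ultimately have "(\<Sum>k\<in>constrs (csm D). h k) = 0"
    by (simp add: lagrangian_def h_def right_diff_distrib sum_subtractf csm_def)
  moreover have "(\<Sum>k\<in>constrs (csm D). h k) = (\<Sum>k\<in>B \<union> U \<union> V. h k)"
  proof (rule sum.mono_neutral_right[OF fin])
    show "B \<union> U \<union> V \<subseteq> constrs (csm D)"
      by (auto simp: B_def U_def V_def csm_def)
    show "\<forall>k\<in>constrs (csm D) - (B \<union> U \<union> V). h k = 0"
    proof
      fix k assume k: "k \<in> constrs (csm D) - (B \<union> U \<union> V)"
      then have idx: "csm_index D k" by (simp add: csm_def)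
      show "h k = 0"
      proof (cases k)
        case (Ohm l t)
        then show ?thesis
          using feasible_csmD[OF feas idx] by (simp add: h_def y_def)
      qed (use k idx in \<open>auto simp: h_def y_def energy_at_def alpha_at_def B_def U_def V_def\<close>)
    qed
  qed
  moreover have "(\<Sum>k\<in>B \<union> U \<union> V. h k) = (\<Sum>k\<in>B. h k) + (\<Sum>k\<in>U. h k) + (\<Sum>k\<in>V. h k)"
  proof -
    have "finite B" "finite U" "finite V"
      using v by (simp_all add: B_def U_def V_def periods_def)
    moreover have "B \<inter> U = {}" "(B \<union> U) \<inter> V = {}"
      by (auto simp: B_def U_def V_def)
    ultimately show ?thesis by (simp add: sum.union_disjoint)
  qed
  moreover have "(\<Sum>k\<in>B. h k) =
      - (\<Sum>t\<in>periods D. \<Sum>l\<in>lines D. (p (Balance (fst l) t) - p (Balance (snd l) t)) * flow x l t)"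
  proof -
    have "(\<Sum>k\<in>B. h k) = (\<Sum>t\<in>periods D. \<Sum>i\<in>nodes D. h (Balance i t))"
      unfolding B_def sum.cartesian_product
      by (subst sum.reindex) (auto simp: inj_on_def case_prod_unfold)
    also have "\<dots> = (\<Sum>t\<in>periods D. - (\<Sum>i\<in>nodes D. p (Balance i t) *
        ((\<Sum>l\<in>lines_from D i. flow x l t) - (\<Sum>l\<in>lines_to D i. flow x l t))))"
      by (simp add: h_def y_def sum_negf right_diff_distrib sum_subtractf)
    finally show ?thesis
      unfolding sum_net_export[OF valid] sum_negf .
  qed
  moreover have "(\<Sum>k\<in>U. h k) = (\<Sum>t\<in>periods D. \<Sum>l\<in>lines D. p (FlowMax l t) * flow x l t)"
    unfolding U_def sum.cartesian_product
    by (subst sum.reindex) (auto simp: inj_on_def case_prod_unfold h_def y_def)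
  moreover have "(\<Sum>k\<in>V. h k) = (\<Sum>t\<in>periods D. \<Sum>l\<in>lines D. p (FlowMin l t) * flow x l t)"
    unfolding V_def sum.cartesian_product
    by (subst sum.reindex) (auto simp: inj_on_def case_prod_unfold h_def y_def)
  ultimately show ?thesis
    by (simp add: distrib_right sum.distrib)
qed

text \<open>
  A nonzero \<open>u\<close> forces \<open>f = F \<ge> 0\<close> and a nonzero \<open>v\<close> forces \<open>f = - F \<le> 0\<close>.
\<close>

lemma slack_pair_times_flow:
  fixes u v f F :: real
  assumes "u * (f - F) = 0" "v * (f + F) = 0" "0 \<le> F"
  shows "(u + v) * f = (u - v) * \<bar>f\<bar>"
  using assms by (auto simp: abs_if eq_neg_iff_add_eq_0[symmetric])

theorem theorem6:
  fixes D :: "('n, 'g, 's) grid"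
    and x :: "('n, 'g, 's) csm_vars"
    and p :: "('n, 'g, 's) con \<Rightarrow> real"
  assumes "valid_grid D"
    and "optimal (csm D) x"
    and "dual_optimal (csm D) p"
  shows "(\<Sum>t\<in>periods D. \<Sum>g\<in>gens D. emission D g * gen x g t) =
    (\<Sum>t\<in>periods D.
       (\<Sum>i\<in>nodes D. LME x p i t * demand D i t)
       + (\<Sum>g\<in>gens D. (emission D g - LME x p (gen_node D g) t) * gen x g t)
       + (\<Sum>l\<in>lines D. SCI x p l t * \<bar>flow x l t\<bar>)
       + (\<Sum>s\<in>stores D. LME x p (sto_node D s) t * (charge x s t - discharge x s t)))"
proof -
  note valid = assms(1) and opt = assms(2) and dual = assms(3)
  have feas: "feasible (csm D) x" using opt by (simp add: optimal_def)
  let ?po = "p StrongDuality"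
  have sci: "SCI x p l t * \<bar>flow x l t\<bar> =
      (p (FlowMax l t) + p (FlowMin l t)) * flow x l t
      + ?po * ((rho_p x l t + rho_m x l t) * flow x l t)"
    if l: "l \<in> lines D" and t: "t \<in> periods D" for l t
  proof -
    (* The flow lies between -fmax and fmax, so feasibility alone makes the limit nonnegative. *)
    have nonneg: "0 \<le> fmax D l"
      using feasible_csmD[OF feas, of "FlowMax l t"] feasible_csmD[OF feas, of "FlowMin l t"] l t
      by simp
    have cs: "p k * (csm_lhs D k x - csm_rhs D k) = 0" if "csm_index D k" for k
      using complementary_slackness[OF finite_constrs_csm[OF valid] affine_csm opt dual, of k] that
      by (simp add: csm_def)
    have "(p (FlowMax l t) + p (FlowMin l t)) * flow x l t =
        (p (FlowMax l t) - p (FlowMin l t)) * \<bar>flow x l t\<bar>"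
      using cs[of "FlowMax l t"] cs[of "FlowMin l t"] l t
      by (intro slack_pair_times_flow[OF _ _ nonneg]) simp_all
    moreover have "(rho_p x l t + rho_m x l t) * flow x l t =
        (rho_p x l t - rho_m x l t) * \<bar>flow x l t\<bar>"
      by (intro slack_pair_times_flow[OF _ _ nonneg] congestion_price_slackness[OF valid feas l t])
    ultimately show ?thesis by (simp add: SCI_def distrib_right)
  qed
  have "(\<Sum>t\<in>periods D. \<Sum>l\<in>lines D. SCI x p l t * \<bar>flow x l t\<bar>) =
      (\<Sum>t\<in>periods D. \<Sum>l\<in>lines D. (p (FlowMax l t) + p (FlowMin l t)) * flow x l t)
      + ?po * (\<Sum>t\<in>periods D. \<Sum>l\<in>lines D. (rho_p x l t + rho_m x l t) * flow x l t)"
    unfolding sum_distrib_left sum.distrib[symmetric]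
    by (intro sum.cong refl sci)
  also have "\<dots> =
      (\<Sum>t\<in>periods D. \<Sum>l\<in>lines D.
        (p (Balance (fst l) t) - p (Balance (snd l) t)) * flow x l t)
      + ?po * (\<Sum>t\<in>periods D. \<Sum>l\<in>lines D.
        (price x (fst l) t - price x (snd l) t) * flow x l t)"
    by (simp only: balance_multiplier_differences[OF valid opt dual]
        price_differences[OF valid feas] cong: sum.cong)
  also have "\<dots> =
      (\<Sum>t\<in>periods D. \<Sum>l\<in>lines D. (LME x p (fst l) t - LME x p (snd l) t) * flow x l t)"
    unfolding sum_distrib_left sum.distrib[symmetric]
    by (intro sum.cong refl) (simp add: LME_def algebra_simps)
  finally have line_accounts: "(\<Sum>t\<in>periods D. \<Sum>l\<in>lines D. SCI x p l t * \<bar>flow x l t\<bar>) =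
      (\<Sum>t\<in>periods D. \<Sum>l\<in>lines D. (LME x p (fst l) t - LME x p (snd l) t) * flow x l t)" .
  have "(\<Sum>t\<in>periods D. \<Sum>i\<in>nodes D. LME x p i t * demand D i t) =
      (\<Sum>t\<in>periods D.
        (\<Sum>g\<in>gens D. LME x p (gen_node D g) t * gen x g t)
        - (\<Sum>l\<in>lines D. (LME x p (fst l) t - LME x p (snd l) t) * flow x l t)
        - (\<Sum>s\<in>stores D. LME x p (sto_node D s) t * (charge x s t - discharge x s t)))"
    by (intro sum.cong refl weighted_balance[OF valid feas])
  with line_accounts show ?thesis
    by (simp add: sum.distrib sum_subtractf left_diff_distrib)
qed

end
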